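(* For every $t \in o(n)$, $\mathrm{ACA}(t) \cap \mathrm{REG} \subsetneq \mathrm{LT}$.
   Context: A cellular automaton (CA) is $C=(Q,\delta,\Sigma)$ with finite state set $Q$, local rule $\delta\colon Q^3\to Q$, input alphabet $\Sigma\subseteq Q$, and an inactive state $q\in Q\setminus\Sigma$ with $\delta(z_1,z_2,z_3)=q$ iff $z_2=q$; the global map is $\Delta(c)(z)=\delta(c(z-1),c(z),c(z+1))$ on $Q^{\mathbb{Z}}$. For input $w\in\Sigma^+$ the initial configuration has $c_0(i)=w(i)$ for $0\le i<|w|$ and $q$ elsewhere. An ACA additionally has a nonempty set $A\subseteq Q\setminus\{q\}$ of accept states and accepts $w$ if some $\Delta^\tau(c_0)$ has all cells in $A\cup\{q\}$; the least such $\tau$ is the acceptance time. $\mathrm{ACA}(t)$ is the class of languages $L(C)$ of ACAs accepting every $w\in L(C)$ within $t(|w|)$ steps. Languages are subsets of $\Sigma^+$ (the empty word is disregarded). $\mathrm{REG}$ is the class of regular languages. For a word $w$ and $k\in\mathbb{N}_0$, $p_k(w)$, $s_k(w)$, $I_k(w)$ denote the prefix, suffix, and set of infixes of length $k$ of $w$, with $p_k(w)=s_k(w)=w$ and $I_k(w)=\{w\}$ if $k\ge|w|$. A language $L\subseteq\Sigma^*$ is locally testable if there is $k\in\mathbb{N}_+$ such that for all $w_1,w_2$ with $p_k(w_1)=p_k(w_2)$, $I_k(w_1)=I_k(w_2)$, $s_k(w_1)=s_k(w_2)$ we have $w_1\in L\iff w_2\in L$; $\mathrm{LT}$ is the class of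 locally testable languages. *)

theory Defs
  imports
    Complex_Main
    "HOL-Library.Landau_Symbols"
    "HOL-Library.Sublist"
    "HOL-Library.Infinite_Typeclass"
begin

section \<open>Cellular automata\<close>

record 'a ca =
  states :: "'a set"
  local_rule :: "'a \<Rightarrow> 'a \<Rightarrow> 'a \<Rightarrow> 'a"
  alphabet :: "'a set"
  inactive :: 'a

definition is_ca :: "('a, 'b) ca_scheme \<Rightarrow> bool" where
  "is_ca C \<longleftrightarrow>
     finite (states C) \<and>
     (\<forall>x\<in>states C. \<forall>y\<in>states C. \<forall>z\<in>states C. local_rule C x y z \<in> states C) \<and>
     alphabet C \<subseteq> states C \<and>
     inactive C \<in> states C - alphabet C \<and>
     (\<forall>x\<in>states C. \<forall>y\<in>states C. \<forall>z\<in>states C.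
        local_rule C x y z = inactive C \<longleftrightarrow> y = inactive C)"

definition global_map :: "('a, 'b) ca_scheme \<Rightarrow> (int \<Rightarrow> 'a) \<Rightarrow> (int \<Rightarrow> 'a)" where
  "global_map C c = (\<lambda>z. local_rule C (c (z - 1)) (c z) (c (z + 1)))"

definition init_config :: "('a, 'b) ca_scheme \<Rightarrow> 'a list \<Rightarrow> (int \<Rightarrow> 'a)" where
  "init_config C w =
     (\<lambda>i. if 0 \<le> i \<and> i < int (length w) then w ! nat i else inactive C)"

record 'a aca = "'a ca" +
  accept_states :: "'a set"

definition is_aca :: "'a aca \<Rightarrow> bool" where
  "is_aca C \<longleftrightarrow>
     is_ca C \<and> accept_states C \<noteq> {} \<and> accept_states C \<subseteq> states C - {inactive C}"

definition accepting_at :: "'a aca \<Rightarrow> 'a list \<Rightarrow> nat \<Rightarrow> bool" where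
  "accepting_at C w \<tau> \<longleftrightarrow>
     (\<forall>z. (global_map C ^^ \<tau>) (init_config C w) z \<in> accept_states C \<union> {inactive C})"

definition aca_lang :: "'a aca \<Rightarrow> 'a list set" where
  "aca_lang C = {w. w \<in> lists (alphabet C) \<and> w \<noteq> [] \<and> (\<exists>\<tau>. accepting_at C w \<tau>)}"

definition acceptance_time :: "'a aca \<Rightarrow> 'a list \<Rightarrow> nat" where
  "acceptance_time C w = (LEAST \<tau>. accepting_at C w \<tau>)"

section \<open>Language classes\<close>

text \<open>
  State sets and alphabets are finite subsets of a symbol type \<open>'a\<close>. The classes below are
  intended for infinite \<open>'a\<close>, so that, up to renaming, all finite state sets and alphabets
  occur. All languages are sets of nonempty words.
\<close>

definition ACA :: "(nat \<Rightarrow> nat) \<Rightarrow> 'a list set set" where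
  "ACA t = {aca_lang C | C.
     is_aca C \<and> (\<forall>w\<in>aca_lang C. acceptance_time C w \<le> t (length w))}"

record 'a dfa =
  dfa_states :: "nat set"
  dfa_alphabet :: "'a set"
  dfa_step :: "nat \<Rightarrow> 'a \<Rightarrow> nat"
  dfa_start :: nat
  dfa_final :: "nat set"

definition is_dfa :: "'a dfa \<Rightarrow> bool" where
  "is_dfa M \<longleftrightarrow>
     finite (dfa_states M) \<and> finite (dfa_alphabet M) \<and>
     (\<forall>s\<in>dfa_states M. \<forall>a\<in>dfa_alphabet M. dfa_step M s a \<in> dfa_states M) \<and>
     dfa_start M \<in> dfa_states M \<and> dfa_final M \<subseteq> dfa_states M"

definition dfa_lang :: "'a dfa \<Rightarrow> 'a list set" where
  "dfa_lang M =
     {w. w \<in> lists (dfa_alphabet M) \<and> foldl (dfa_step M) (dfa_start M) w \<in> dfa_final M}"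

definition REG :: "'a list set set" where
  "REG = {L. [] \<notin> L \<and> (\<exists>M. is_dfa M \<and> L = dfa_lang M)}"

definition pref :: "nat \<Rightarrow> 'a list \<Rightarrow> 'a list" where
  "pref k w = take k w"

definition suff :: "nat \<Rightarrow> 'a list \<Rightarrow> 'a list" where
  "suff k w = drop (length w - k) w"

definition infixes :: "nat \<Rightarrow> 'a list \<Rightarrow> 'a list set" where
  "infixes k w = (if k \<ge> length w then {w} else {u. length u = k \<and> sublist u w})"

definition locally_testable :: "'a set \<Rightarrow> 'a list set \<Rightarrow> bool" where
  "locally_testable \<Sigma> L \<longleftrightarrow>
     L \<subseteq> lists \<Sigma> \<and>
     (\<exists>k>0. \<forall>w1\<in>lists \<Sigma>. \<forall>w2\<in>lists \<Sigma>.
        pref k w1 = pref k w2 \<and> infixes k w1 = infixes k w2 \<and> suff k w1 = suff k w2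
        \<longrightarrow> (w1 \<in> L \<longleftrightarrow> w2 \<in> L))"

definition LT :: "'a list set set" where
  "LT = {L. [] \<notin> L \<and> (\<exists>\<Sigma>. finite \<Sigma> \<and> locally_testable \<Sigma> L)}"

end

theory Submission
  imports Defs "HOL-Library.FuncSet"
begin

text \<open>
  An ACA accepting a word \<open>W\<close> at time \<open>\<tau>\<close> also accepts every word all of whose
  \<open>\<tau>\<close>-neighbourhoods (including the inactive border) occur in \<open>W\<close>. For a DFA with state set \<open>S\<close>,
  every word of length \<open>K = card (S \<rightarrow> S)\<close> contains, after some prefix \<open>a\<close>, a nonempty
  factor \<open>e\<close> such that \<open>a\<close> and \<open>a e\<close> induce the same map on \<open>S\<close>. After each
  letter of a word \<open>w\<close> insert \<open>N\<close> copies of such a loop \<open>e\<close>, chosen as a function of the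
  last \<open>K\<close> letters only (nothing is inserted if these do not end with a loop). The expanded
  word leads to the same state as \<open>w\<close> and its length is linear in \<open>N\<close>, so for large \<open>N\<close> its
  acceptance time is at most \<open>N\<close>. Since inserted blocks have length at least \<open>N\<close> and occur in
  every window of \<open>K\<close> letters, an \<open>N\<close>-neighbourhood in the expanded word is determined by
  \<open>3 K + 1\<close> consecutive letters of \<open>w\<close>. Hence membership depends only on the prefix, the infixes and the
  suffix of that length. The inclusion is strict because of the language of all words over
  \<open>{a, b}\<close> containing \<open>b\<close>: an automaton accepting \<open>a\<^sup>n b a\<^sup>n\<close> in fewer than \<open>n / 2\<close> steps also
  accepts \<open>a\<^sup>n\<close>.
\<close>

subsection \<open>Locality of acceptance\<close>

lemma global_map_funpow_Suc:
  "(global_map C ^^ Suc \<tau>) c z = local_rule C ((global_map C ^^ \<tau>) c (z - 1))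
     ((global_map C ^^ \<tau>) c z) ((global_map C ^^ \<tau>) c (z + 1))"
  by (simp add: global_map_def[of C "(global_map C ^^ \<tau>) c"])

text \<open>Information travels one cell per step, so the ball of radius \<tau> around a cell fixes
  its state at time \<tau>. Allowing two centres makes positions of different words
  comparable.\<close>

lemma global_map_funpow_cong:
  assumes "\<forall>d. \<bar>d\<bar> \<le> int \<tau> \<longrightarrow> c (z + d) = c' (z' + d)"
  shows "(global_map C ^^ \<tau>) c z = (global_map C ^^ \<tau>) c' z'"
  using assms
proof (induction \<tau> arbitrary: z z')
  case 0
  then show ?case by (auto dest: spec[of _ 0])
next
  case (Suc \<tau>)
  have eq: "(global_map C ^^ \<tau>) c (z + e) = (global_map C ^^ \<tau>) c' (z' + e)" if "\<bar>e\<bar> \<le> 1" for e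
  proof (rule Suc.IH, intro allI impI)
    fix d :: int
    assume "\<bar>d\<bar> \<le> int \<tau>"
    with that have "\<bar>e + d\<bar> \<le> int (Suc \<tau>)" by linarith
    with Suc.prems have "c (z + (e + d)) = c' (z' + (e + d))" by blast
    then show "c (z + e + d) = c' (z' + e + d)" by (simp add: add.assoc)
  qed
  from eq[of "-1"] eq[of 0] eq[of 1] show ?case
    by (simp add: global_map_funpow_Suc del: funpow.simps)
qed

lemma global_map_funpow_states:
  assumes "is_ca C" and "range c \<subseteq> states C"
  shows "(global_map C ^^ \<tau>) c z \<in> states C"
proof (induction \<tau> arbitrary: z)
  case 0
  then show ?case using assms by auto
next
  case (Suc \<tau>)
  then show ?case using assms(1) by (simp add: global_map_funpow_Suc is_ca_def del: funpow.simps)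
qed

text \<open>Confines the check of acceptance to the cells of the input, since all other cells pass
  it at every time.\<close>

lemma global_map_funpow_inactive:
  assumes "is_ca C" and "range c \<subseteq> states C" and "c z = inactive C"
  shows "(global_map C ^^ \<tau>) c z = inactive C"
proof (induction \<tau>)
  case 0
  then show ?case using assms by simp
next
  case (Suc \<tau>)
  have "local_rule C x (inactive C) y = inactive C" if "x \<in> states C" "y \<in> states C" for x y
    using assms(1) that by (auto simp: is_ca_def)
  then show ?case
    using Suc global_map_funpow_states[OF assms(1,2)] by (simp add: global_map_funpow_Suc del: funpow.simps)
qed

lemma range_init_config:
  assumes "is_ca C" and "w \<in> lists (alphabet C)"
  shows "range (init_config C w) \<subseteq> states C"
proof -
  have "w ! i \<in> states C" if "i < length w" for i
    using assms that nth_mem[OF that] by (auto simp: is_ca_def)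
  then show ?thesis using assms(1) by (auto simp: init_config_def is_ca_def)
qed

text \<open>The ball around offset \<open>r\<close> of \<open>X\<close> may leave \<open>X\<close>
  only on a side where both words end, and beyond that end both configurations are inactive.\<close>

lemma init_config_append_cong:
  assumes "\<tau> \<le> r \<or> A = [] \<and> A' = []" and "r + \<tau> < length X \<or> B = [] \<and> B' = []"
    and "\<bar>d\<bar> \<le> int \<tau>" and "r < length X"
  shows "init_config C (A' @ X @ B') (int (length A' + r) + d)
       = init_config C (A @ X @ B) (int (length A + r) + d)"
proof -
  have *: "init_config C (A @ X @ B) (int (length A) + j) = init_config C X j"
    if "0 \<le> j \<or> A = []" "j < int (length X) \<or> B = []" for j :: int and A B
    using that by (auto simp: init_config_def nth_append nat_add_distrib nat_less_iff)
  have "0 \<le> int r + d \<or> A = [] \<and> A' = []" "int r + d < int (length X) \<or> B = [] \<and> B' = []"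
    using assms by linarith+
  then show ?thesis
    using *[of "int r + d" A B] *[of "int r + d" A' B'] by (auto simp: add.assoc)
qed

text \<open>Acceptance asks the same of every cell, so it suffices to match each position of
  \<open>W'\<close> with some position of \<open>W\<close> that has the same ball; the matches need
  not fit together.\<close>

lemma accepting_at_local:
  assumes "is_aca C" and "W' \<in> lists (alphabet C)" and "accepting_at C W \<tau>"
    and "\<And>i. i < length W' \<Longrightarrow> \<exists>A A' X B B' r. W = A @ X @ B \<and> W' = A' @ X @ B' \<and>
           i = length A' + r \<and> r < length X \<and> (\<tau> \<le> r \<or> A = [] \<and> A' = []) \<and>
           (r + \<tau> < length X \<or> B = [] \<and> B' = [])"
  shows "accepting_at C W' \<tau>"
  unfolding accepting_at_def
proof
  fix z :: int
  let ?c = "init_config C W'"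
  have ca: "is_ca C" using assms(1) by (simp add: is_aca_def)
  show "(global_map C ^^ \<tau>) ?c z \<in> accept_states C \<union> {inactive C}"
  proof (cases "0 \<le> z \<and> z < int (length W')")
    case False
    then have "?c z = inactive C" by (auto simp: init_config_def)
    then show ?thesis
      using global_map_funpow_inactive[OF ca range_init_config[OF ca assms(2)]] by simp
  next
    case True
    then have "nat z < length W'" by linarith
    from assms(4)[OF this] obtain A A' X B B' r where
      W: "W = A @ X @ B" "W' = A' @ X @ B'" and r: "nat z = length A' + r" "r < length X"
      and bounds: "\<tau> \<le> r \<or> A = [] \<and> A' = []" "r + \<tau> < length X \<or> B = [] \<and> B' = []" by blast
    have z: "z = int (length A' + r)" using r(1) True by linarith
    have "(global_map C ^^ \<tau>) ?c z
        = (global_map C ^^ \<tau>) (init_config C W) (int (length A + r))"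
      unfolding z W using init_config_append_cong[OF bounds _ r(2)]
      by (intro global_map_funpow_cong) blast
    then show ?thesis using assms(3) by (simp add: accepting_at_def)
  qed
qed

subsection \<open>Expanding words by local insertions\<close>

text \<open>The context \<open>c\<close> collects original letters only, so an insertion never
  depends on earlier insertions.\<close>

fun expand :: "('a list \<Rightarrow> 'a list) \<Rightarrow> 'a list \<Rightarrow> 'a list \<Rightarrow> 'a list" where
  "expand h c [] = []"
| "expand h c (a # w) = a # h (c @ [a]) @ expand h (c @ [a]) w"

lemma expand_append: "expand h c (u @ v) = expand h c u @ expand h (c @ u) v"
  by (induction u arbitrary: c) auto

lemma expand_in_lists:
  assumes "\<And>u. u \<in> lists \<Sigma> \<Longrightarrow> h u \<in> lists \<Sigma>" and "c \<in> lists \<Sigma>" and "w \<in> lists \<Sigma>"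
  shows "expand h c w \<in> lists \<Sigma>"
  using assms(2,3)
proof (induction w arbitrary: c)
  case (Cons a w)
  then have "c @ [a] \<in> lists \<Sigma>" "w \<in> lists \<Sigma>" by auto
  with Cons assms(1)[of "c @ [a]"] show ?case by auto
qed simp

lemma foldl_expand:
  assumes "\<And>u. u \<in> lists \<Sigma> \<Longrightarrow> foldl f q (u @ h u) = foldl f q u"
    and "c \<in> lists \<Sigma>" and "w \<in> lists \<Sigma>"
  shows "foldl f (foldl f q c) (expand h c w) = foldl f q (c @ w)"
  using assms(2,3)
proof (induction w arbitrary: c)
  case (Cons a w)
  then have c: "c @ [a] \<in> lists \<Sigma>" and w: "w \<in> lists \<Sigma>" by auto
  have "foldl f (f (foldl f q c) a) (h (c @ [a])) = foldl f q (c @ [a])"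
    using assms(1)[OF c] by simp
  then show ?case using Cons.IH[OF c w] by simp
qed simp

lemma length_expand_le:
  assumes "\<And>u. length (h u) \<le> m"
  shows "length (expand h c w) \<le> length w * Suc m"
proof (induction w arbitrary: c)
  case (Cons a w)
  show ?case using Cons[of "c @ [a]"] assms[of "c @ [a]"] by simp
qed simp

text \<open>\<open>h\<close> cannot see past the last \<open>K\<close> letters, and the known part
  \<open>v\<close> of the context only grows while \<open>w\<close> is read.\<close>

lemma expand_context_cong:
  assumes "\<And>c c' u. length u \<ge> K \<Longrightarrow> h (c @ u) = h (c' @ u)" and "length v \<ge> K"
  shows "expand h (c @ v) w = expand h (c' @ v) w"
  using assms(2)
proof (induction w arbitrary: v)
  case (Cons a w)
  then show ?case using Cons.IH[of "v @ [a]"] assms(1)[of "v @ [a]" c c'] by simp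
qed simp

text \<open>\<open>m = 0\<close> is the original letter \<open>a\<close>, larger \<open>m\<close>
  are the letters inserted after it; hence \<open>m\<close> may equal the length of the
  insertion.\<close>

lemma expand_position:
  assumes "i < length (expand h c w)"
  shows "\<exists>s a t m. w = s @ a # t \<and> i = length (expand h c s) + m \<and> m \<le> length (h (c @ s @ [a]))"
  using assms
proof (induction w arbitrary: c i)
  case (Cons a w)
  let ?n = "Suc (length (h (c @ [a])))"
  show ?case
  proof (cases "i < ?n")
    case True
    then show ?thesis by (intro exI[of _ "[]"] exI[of _ a] exI[of _ w] exI[of _ i]) simp
  next
    case False
    with Cons.prems have "i - ?n < length (expand h (c @ [a]) w)" by simp
    from Cons.IH[OF this] obtain s b t m where
      "w = s @ b # t" "i - ?n = length (expand h (c @ [a]) s) + m"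
      "m \<le> length (h ((c @ [a]) @ s @ [b]))" by blast
    with False show ?thesis
      by (intro exI[of _ "a # s"] exI[of _ b] exI[of _ t] exI[of _ m]) simp
  qed
qed simp

text \<open>The block \<open>v\<close> determines what is inserted from \<open>l\<close> onward,
  while the expansions of \<open>l\<close> and \<open>r\<close> are to cover the ball on either side
  of \<open>a\<close>. Three blocks of length \<open>K\<close> and the letter \<open>a\<close> give
  the window length; near an end of the word, the window instead reaches that end in both
  words.\<close>

lemma context_decomposition:
  assumes "pref (3 * K + 1) w = pref (3 * K + 1) w'" and "infixes (3 * K + 1) w = infixes (3 * K + 1) w'"
    and "suff (3 * K + 1) w = suff (3 * K + 1) w'"
    and "length w \<ge> 3 * K + 1" and "length w' \<ge> 3 * K + 1" and "w' = s @ a # t"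
  shows "\<exists>x x' v l r y y'. w = x @ v @ l @ a # r @ y \<and> w' = x' @ v @ l @ a # r @ y' \<and> s = x' @ v @ l \<and>
           (length v = K \<and> length l = K \<or> x = [] \<and> x' = [] \<and> v = []) \<and>
           (length r = K \<or> y = [] \<and> y' = [])"
proof -
  let ?k = "3 * K + 1"
  note w' = assms(6)
  have len: "length s + length t + 1 \<ge> ?k" using assms(5) w' by simp
  have decI: ?thesis
    if "w = x @ v @ l @ a # r @ y" "w' = x' @ v @ l @ a # r @ y'" "s = x' @ v @ l"
      "length v = K \<and> length l = K \<or> x = [] \<and> x' = [] \<and> v = []" "length r = K \<or> y = [] \<and> y' = []"
    for x x' v l r y y'
    using that by (intro exI conjI)
  consider "length s < 2 * K" | "length s \<ge> 2 * K" "length t < K" | "length s \<ge> 2 * K" "length t \<ge> K"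
    by linarith
  then show ?thesis
  proof cases
    \<comment> \<open>Near the left end the common prefix contains \<open>s\<close>,
      \<open>a\<close> and a full block \<open>r\<close>, because \<open>t\<close> then has at least
      \<open>K\<close> letters.\<close>
    case 1
    have "pref ?k w' = s @ a # take (3 * K - length s) t"
      using 1 by (simp add: pref_def w' take_Cons' Suc_diff_le)
    moreover have "take (3 * K - length s) t = take K t @ take (2 * K - length s) (drop K t)"
      using take_add[of K "2 * K - length s" t] 1 by simp
    ultimately have "take ?k w = s @ a # take K t @ take (2 * K - length s) (drop K t)"
      using assms(1) by (simp add: pref_def)
    then have "take ?k w @ drop ?k w
        = [] @ [] @ s @ a # take K t @ (take (2 * K - length s) (drop K t) @ drop ?k w)"
      by (simp only: append.simps append.assoc)
    then have "w = [] @ [] @ s @ a # take K t @ (take (2 * K - length s) (drop K t) @ drop ?k w)"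
      unfolding append_take_drop_id .
    moreover have "w' = [] @ [] @ s @ a # take K t @ drop K t" using w' by simp
    ultimately show ?thesis by (rule decI) (use 1 len in simp_all)
  next
    \<comment> \<open>Near the right end the common suffix contains \<open>a # t\<close> and more
      than \<open>2 * K\<close> letters before it; the surplus \<open>p\<close> joins the unmatched
      part on the left.\<close>
    case 2
    let ?d = "length s - (3 * K - length t)"
    have "suff ?k w' = drop ?d s @ a # t"
      using 2 len by (simp add: suff_def w')
    then have "drop (length w - ?k) w = drop ?d s @ a # t" using assms(3) by (simp only: suff_def)
    then have w: "w = take (length w - ?k) w @ drop ?d s @ a # t" by (metis append_take_drop_id)
    define u where "u = drop ?d s"
    have u: "length u = 3 * K - length t" using 2 len by (simp add: u_def)
    define l where "l = drop (length u - K) u"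
    define v where "v = drop (length u - 2 * K) (take (length u - K) u)"
    define p where "p = take (length u - 2 * K) u"
    have "take (length u - K) u = p @ v"
      unfolding p_def v_def
      by (metis append_take_drop_id diff_le_mono2 le_add1 min.absorb1 mult_2 take_take)
    then have pvl: "u = p @ v @ l" unfolding l_def by (metis append.assoc append_take_drop_id)
    have lens: "length l = K" "length v = K" using u 2 by (auto simp: l_def v_def)
    have s: "s = take ?d s @ p @ v @ l" using pvl u_def by (metis append_take_drop_id)
    have "w = (take (length w - ?k) w @ p) @ v @ l @ a # t @ []" using w pvl u_def
      by (metis append.assoc append_Nil2)
    moreover have "w' = (take ?d s @ p) @ v @ l @ a # t @ []" using w' s by (metis append.assoc append_Nil2)
    moreover have "s = (take ?d s @ p) @ v @ l" using s unfolding append.assoc .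
    ultimately show ?thesis by (rule decI) (simp_all add: lens)
  next
    \<comment> \<open>In the middle \<open>v @ l @ a # r\<close> is an infix of length exactly
      \<open>3 * K + 1\<close>, so it occurs somewhere in \<open>w\<close>, possibly at another
      position.\<close>
    case 3
    define x' where "x' = take (length s - 2 * K) s"
    define v where "v = take K (drop (length s - 2 * K) s)"
    define l where "l = drop K (drop (length s - 2 * K) s)"
    define r where "r = take K t"
    have s: "s = x' @ v @ l" by (simp only: x'_def v_def l_def append_take_drop_id)
    have lens: "length v = K" "length l = K" "length r = K"
      using 3 by (auto simp: v_def l_def r_def)
    have w'': "w' = x' @ v @ l @ a # r @ drop K t" using w' s by (simp add: r_def)
    \<comment> \<open>\<open>infixes\<close> switches to a singleton already at length
      \<open>?k\<close>, where the word is its only infix of that length.\<close>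
    have inf: "u \<in> infixes ?k z \<longleftrightarrow> sublist u z" if "length u = ?k" "length z \<ge> ?k" for u z :: "'a list"
    proof (cases "length z = ?k")
      case True
      then show ?thesis using that
        by (auto simp: infixes_def dest: sublist_length_le) (auto simp: sublist_def)
    qed (use that in \<open>auto simp: infixes_def\<close>)
    have "sublist (v @ l @ a # r) w'" unfolding w'' sublist_def by (metis append.assoc append_Cons)
    then have "sublist (v @ l @ a # r) w"
      using inf[OF _ assms(4), of "v @ l @ a # r"] inf[OF _ assms(5), of "v @ l @ a # r"] assms(2) lens by simp
    then obtain x y where "w = x @ (v @ l @ a # r) @ y" by (auto simp: sublist_def)
    then have "w = x @ v @ l @ a # r @ y" by simp
    from this w'' s show ?thesis by (rule decI) (simp_all add: lens)
  qed
qed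

text \<open>Both words expand the common window of \<open>context_decomposition\<close> to the same
  \<open>X\<close>, as \<open>v\<close> supplies the letters that \<open>h\<close> reads. By
  \<open>long\<close>, blocks \<open>l\<close> and \<open>r\<close> of length \<open>K\<close>
  expand to at least \<tau> letters, which yields the matching for
  \<open>accepting_at_local\<close>.\<close>

lemma accepting_at_expand:
  assumes "is_aca C" and "\<And>u. u \<in> lists \<Sigma> \<Longrightarrow> h u \<in> lists \<Sigma>" and "\<Sigma> \<subseteq> alphabet C"
    and cong: "\<And>c c' u. length u \<ge> K \<Longrightarrow> h (c @ u) = h (c' @ u)"
    and long: "\<And>c u. u \<in> lists \<Sigma> \<Longrightarrow> length u = K \<Longrightarrow> \<tau> \<le> length (expand h c u)"
    and "w' \<in> lists \<Sigma>"
    and "pref (3 * K + 1) w = pref (3 * K + 1) w'" and "infixes (3 * K + 1) w = infixes (3 * K + 1) w'"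
    and "suff (3 * K + 1) w = suff (3 * K + 1) w'"
    and "length w \<ge> 3 * K + 1" and "length w' \<ge> 3 * K + 1"
    and "accepting_at C (expand h [] w) \<tau>"
  shows "accepting_at C (expand h [] w') \<tau>"
proof (rule accepting_at_local[OF assms(1) _ assms(12)])
  show "expand h [] w' \<in> lists (alphabet C)"
    using expand_in_lists[of \<Sigma> h "[]" w'] assms(2,3,6) lists_mono[OF assms(3)] by auto
next
  fix i
  assume "i < length (expand h [] w')"
  from expand_position[OF this] obtain s a t m where
    w': "w' = s @ a # t" and i: "i = length (expand h [] s) + m" and m: "m \<le> length (h (s @ [a]))"
    by auto
  from context_decomposition[OF assms(7-11) w'] obtain x x' v l r y y' where
    dec: "w = x @ v @ l @ a # r @ y" "w' = x' @ v @ l @ a # r @ y'" and s: "s = x' @ v @ l"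
    and left: "length v = K \<and> length l = K \<or> x = [] \<and> x' = [] \<and> v = []"
    and right: "length r = K \<or> y = [] \<and> y' = []" by blast
  have \<Sigma>: "l \<in> lists \<Sigma>" "r \<in> lists \<Sigma>" using assms(6) dec(2) by auto
  define X where "X = expand h (x' @ v) (l @ a # r)"
  have X: "expand h (x @ v) (l @ a # r) = X"
    unfolding X_def using left expand_context_cong[where K = K and h = h and v = v, OF cong] by auto
  have W: "expand h [] w = expand h [] (x @ v) @ X @ expand h (x @ v @ l @ a # r) y"
    unfolding dec X[symmetric] by (simp add: expand_append)
  have W': "expand h [] w' = expand h [] (x' @ v) @ X @ expand h (x' @ v @ l @ a # r) y'"
    unfolding dec X_def by (simp add: expand_append)
  have X_split: "X = expand h (x' @ v) l @ (a # h (s @ [a])) @ expand h (s @ [a]) r"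
    unfolding X_def s by (simp add: expand_append)
  define j where "j = length (expand h (x' @ v) l) + m"
  have ij: "i = length (expand h [] (x' @ v)) + j"
    unfolding i s j_def by (simp add: expand_append)
  have "j < length X" using m by (simp add: X_split j_def)
  moreover have "\<tau> \<le> j \<or> expand h [] (x @ v) = [] \<and> expand h [] (x' @ v) = []"
    using left long[OF \<Sigma>(1), of "x' @ v"] by (auto simp: j_def)
  \<comment> \<open>The letter \<open>a\<close> itself makes the inequality strict, even at the last
    letter of its insertion.\<close>
  moreover have "j + \<tau> < length X \<or>
      expand h (x @ v @ l @ a # r) y = [] \<and> expand h (x' @ v @ l @ a # r) y' = []"
    using right m long[OF \<Sigma>(2), of "s @ [a]"] by (auto simp: j_def X_split)
  ultimately show "\<exists>A A' X B B' r. expand h [] w = A @ X @ B \<and> expand h [] w' = A' @ X @ B' \<and>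
           i = length A' + r \<and> r < length X \<and> (\<tau> \<le> r \<or> A = [] \<and> A' = []) \<and>
           (r + \<tau> < length X \<or> B = [] \<and> B' = [])"
    using W W' ij by blast
qed

subsection \<open>Loops in finite automata\<close>

text \<open>The equation is required from all states at once, so being a loop depends on the window
  \<open>u\<close> alone and not on the state in which it is entered.\<close>

definition dfa_loop :: "'a dfa \<Rightarrow> 'a list \<Rightarrow> 'a list \<Rightarrow> bool" where
  "dfa_loop M u e \<longleftrightarrow> e \<noteq> [] \<and> (\<exists>c a. u = c @ a @ e \<and>
     (\<forall>q\<in>dfa_states M. foldl (dfa_step M) q (a @ e) = foldl (dfa_step M) q a))"

definition some_loop :: "'a dfa \<Rightarrow> 'a list \<Rightarrow> 'a list" where
  "some_loop M u = (if \<exists>e. dfa_loop M u e then SOME e. dfa_loop M u e else [])"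

lemma some_loop_cases: "some_loop M u = [] \<or> dfa_loop M u (some_loop M u)"
  by (auto simp: some_loop_def intro: someI)

lemma some_loop_nonempty:
  assumes "dfa_loop M u e"
  shows "some_loop M u \<noteq> []"
proof -
  have "dfa_loop M u (SOME e. dfa_loop M u e)" using assms by (rule someI)
  then show ?thesis using assms by (auto simp: some_loop_def dfa_loop_def)
qed

lemma suffix_some_loop: "suffix (some_loop M u) u"
  using some_loop_cases[of M u] unfolding dfa_loop_def suffix_def by (metis append.assoc append_Nil2)

lemma foldl_dfa_states:
  assumes "is_dfa M" and "q \<in> dfa_states M" and "u \<in> lists (dfa_alphabet M)"
  shows "foldl (dfa_step M) q u \<in> dfa_states M"
  using assms(3,2)
proof (induction u arbitrary: q)
  case (Cons a u)
  then show ?case using assms(1) by (simp add: is_dfa_def)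
qed simp

lemma foldl_concat_replicate:
  assumes "foldl f q e = q"
  shows "foldl f q (concat (replicate N e)) = q"
  using assms by (induction N) auto

text \<open>As the window ends in \<open>a @ e\<close>, the state after \<open>u\<close> is already
  reached before the final \<open>e\<close>; reading \<open>e\<close> again therefore leads back to
  it, as often as desired.\<close>

lemma foldl_some_loop:
  assumes "is_dfa M" and "q \<in> dfa_states M" and "u \<in> lists (dfa_alphabet M)"
  shows "foldl (dfa_step M) q (u @ concat (replicate N (some_loop M (suff K u)))) = foldl (dfa_step M) q u"
proof (cases "some_loop M (suff K u) = []")
  case True
  then show ?thesis by (simp add: concat_eq_Nil_conv)
next
  case False
  let ?e = "some_loop M (suff K u)" and ?f = "foldl (dfa_step M)"
  have "dfa_loop M (suff K u) ?e" using False some_loop_cases by metis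
  then obtain c a where ca: "suff K u = c @ a @ ?e"
    and loop: "\<forall>q\<in>dfa_states M. ?f q (a @ ?e) = ?f q a" by (auto simp: dfa_loop_def)
  obtain b where "u = b @ suff K u" by (metis append_take_drop_id suff_def)
  with ca have u: "u = (b @ c) @ a @ ?e" by simp
  then have bc: "b @ c \<in> lists (dfa_alphabet M)" using assms(3) by (metis append_in_lists_conv)
  have "?f (?f q (b @ c)) (a @ ?e) = ?f (?f q (b @ c)) a"
    using loop foldl_dfa_states[OF assms(1,2) bc] by blast
  then have "?f q u = ?f (?f q (b @ c)) a" by (subst u) simp
  moreover from this have "?f (?f q u) ?e = ?f q u"
    using \<open>?f (?f q (b @ c)) (a @ ?e) = _\<close> by simp
  ultimately show ?thesis by (simp add: foldl_concat_replicate)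
qed

text \<open>Pigeonhole: the \<open>length x + 1\<close> prefixes of \<open>x\<close> induce at most
  \<open>length x\<close> maps on the states, so two of them act alike, and \<open>e\<close> is what
  lies between them.\<close>

lemma dfa_window_loop:
  assumes "is_dfa M" and "x \<in> lists (dfa_alphabet M)"
    and "length x = card (dfa_states M \<rightarrow>\<^sub>E dfa_states M)"
  shows "\<exists>a e b. x = a @ e @ b \<and> e \<noteq> [] \<and>
     (\<forall>q\<in>dfa_states M. foldl (dfa_step M) q (a @ e) = foldl (dfa_step M) q a)"
proof -
  let ?S = "dfa_states M"
  define F where "F i = restrict (\<lambda>q. foldl (dfa_step M) q (take i x)) ?S" for i
  have "F i \<in> ?S \<rightarrow>\<^sub>E ?S" for i
    unfolding F_def using foldl_dfa_states[OF assms(1)] assms(2)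
    by (auto dest: in_set_takeD)
  then have "F ` {..length x} \<subseteq> ?S \<rightarrow>\<^sub>E ?S" by blast
  moreover have "finite (?S \<rightarrow>\<^sub>E ?S)" using assms(1) by (simp add: is_dfa_def finite_PiE)
  ultimately have "card (F ` {..length x}) \<le> length x" using assms(3) card_mono by metis
  then have "\<not> inj_on F {..length x}" using card_image[of F "{..length x}"] by auto
  then obtain i j where ij: "i < j" "j \<le> length x" "F i = F j"
    by (auto simp: inj_on_def) (metis nat_neq_iff)
  define e where "e = drop i (take j x)"
  have j: "take j x = take i x @ e"
    unfolding e_def using ij(1) by (metis append_take_drop_id less_imp_le min.absorb1 take_take)
  have "x = take i x @ e @ drop j x" using j by (metis append.assoc append_take_drop_id)
  moreover have "e \<noteq> []" using ij by (simp add: e_def)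
  moreover have "foldl (dfa_step M) q (take i x @ e) = foldl (dfa_step M) q (take i x)" if "q \<in> ?S" for q
    using fun_cong[OF ij(3), of q] that by (simp add: F_def j)
  ultimately show ?thesis by blast
qed

lemma length_concat_replicate: "length (concat (replicate N e)) = N * length e"
  by (induction N) auto

lemma length_expand_loops:
  assumes "is_dfa M" and "K = card (dfa_states M \<rightarrow>\<^sub>E dfa_states M)"
    and "u \<in> lists (dfa_alphabet M)" and "length u = K"
  shows "N \<le> length (expand (\<lambda>v. concat (replicate N (some_loop M (suff K v)))) c u)"
proof -
  from dfa_window_loop[OF assms(1,3)] assms(2,4) obtain a e b where
    u: "u = a @ e @ b" and e: "e \<noteq> []" and
    loop: "\<forall>q\<in>dfa_states M. foldl (dfa_step M) q (a @ e) = foldl (dfa_step M) q a" by blast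
  \<comment> \<open>Insertions follow single letters; splitting off the last letter of
    \<open>e\<close> exposes the insertion made after \<open>c @ a @ e\<close>.\<close>
  obtain e' z where ez: "e = e' @ [z]" using e by (metis append_butlast_last_id)
  \<comment> \<open>The window may reach back into \<open>c\<close>, and \<open>d\<close> is what it
    sees there; \<open>dfa_loop\<close> tolerates such a prefix.\<close>
  define d where "d = drop (length c + length (a @ e) - K) c"
  have suff: "suff K (c @ a @ e) = d @ a @ e"
    using assms(4) by (simp add: suff_def u d_def)
  then have "dfa_loop M (suff K (c @ a @ e)) e"
    using e loop by (auto simp: dfa_loop_def)
  then have "some_loop M (suff K (c @ a @ e)) \<noteq> []" by (rule some_loop_nonempty)
  then have "1 \<le> length (some_loop M (suff K (c @ a @ e)))" by (simp add: Suc_le_eq)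
  then have "N \<le> length (concat (replicate N (some_loop M (suff K (c @ a @ e)))))"
    unfolding length_concat_replicate by (metis mult_le_mono2 nat_mult_1_right)
  then show ?thesis by (simp add: u ez expand_append)
qed

subsection \<open>Regular languages recognized in sublinear time\<close>

lemma accepting_at_acceptance_time:
  assumes "w \<in> aca_lang C"
  shows "accepting_at C w (acceptance_time C w)"
  using assms unfolding aca_lang_def acceptance_time_def by (auto intro: LeastI)

text \<open>Eventually \<open>t n\<close> is at most \<open>n / (2 * m)\<close>, so
  \<open>t (f N)\<close> is at most \<open>(N + 1) / 2\<close>, hence at most \<open>N\<close> for
  positive \<open>N\<close>. The lower bound on \<open>f\<close> carries \<open>f N\<close> past the
  threshold.\<close>

lemma sublinear_eventually_le:
  fixes t :: "nat \<Rightarrow> nat" and f :: "nat \<Rightarrow> nat"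
  assumes "(\<lambda>n. real (t n)) \<in> o(\<lambda>n. real n)" and "\<And>N. N \<le> f N" and "\<And>N. f N \<le> m * Suc N"
  shows "\<exists>N>0. t (f N) \<le> N"
proof -
  have "m > 0" using assms(2)[of 1] assms(3)[of 1] by (cases m) auto
  then have "eventually (\<lambda>n. norm (real (t n)) \<le> (1 / (2 * real m)) * norm (real n)) at_top"
    by (intro landau_o.smallD[OF assms(1)]) simp
  then obtain n0 where n0: "\<And>n. n \<ge> n0 \<Longrightarrow> real (t n) \<le> (1 / (2 * real m)) * real n"
    by (auto simp: eventually_at_top_linorder)
  define N where "N = Suc n0"
  have "real (t (f N)) \<le> (1 / (2 * real m)) * real (f N)"
    using assms(2)[of N] by (intro n0) (simp add: N_def)
  also have "\<dots> \<le> (1 / (2 * real m)) * real (m * Suc N)"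
    using assms(3)[of N] by (intro mult_left_mono) (simp_all only: of_nat_le_iff, simp)
  also have "\<dots> = real (Suc N) / 2" using \<open>m > 0\<close> by (simp add: field_simps)
  also have "\<dots> \<le> real N" by (simp add: N_def)
  finally show ?thesis by (intro exI[of _ N]) (simp add: N_def)
qed

lemma pref_short_eq:
  assumes "pref k w = pref k w'" and "length w < k"
  shows "w = w'"
proof -
  have "take k w' = w" using assms by (simp add: pref_def)
  moreover from this have "length w' \<le> k" using assms(2) by (metis length_take min_def nat_neq_iff)
  ultimately show ?thesis by simp
qed

lemma suff_append_cong:
  assumes "length u \<ge> K"
  shows "suff K (c @ u) = suff K (c' @ u)"
  using assms by (simp add: suff_def)

text \<open>Membership passes from \<open>w\<close> to its expansion through \<open>M\<close>, then
  to the expansion of \<open>w'\<close> by acceptance within \<open>N\<close> steps, and back to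
  \<open>w'\<close> through \<open>M\<close>. The number \<open>N\<close> may depend on
  \<open>w\<close>, since the window length does not involve it.\<close>

lemma ACA_REG_closed:
  assumes "(\<lambda>n. real (t n)) \<in> o(\<lambda>n. real n)"
    and C: "is_aca C" "\<forall>w\<in>aca_lang C. acceptance_time C w \<le> t (length w)"
    and M: "is_dfa M" "aca_lang C = dfa_lang M"
    and K: "K = card (dfa_states M \<rightarrow>\<^sub>E dfa_states M)"
    and w': "w' \<in> lists (alphabet C \<inter> dfa_alphabet M)"
    and eq: "pref (3 * K + 1) w = pref (3 * K + 1) w'" "infixes (3 * K + 1) w = infixes (3 * K + 1) w'"
      "suff (3 * K + 1) w = suff (3 * K + 1) w'"
    and w: "w \<in> aca_lang C"
  shows "w' \<in> aca_lang C"
proof (cases "length w < 3 * K + 1 \<or> length w' < 3 * K + 1")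
  case True
  then have "w = w'" using pref_short_eq[OF eq(1)] pref_short_eq[OF eq(1)[symmetric]] by metis
  with w show ?thesis by simp
next
  case False
  then have len: "length w \<ge> 3 * K + 1" "length w' \<ge> 3 * K + 1" by linarith+
  \<comment> \<open>Expanded words are read by both \<open>C\<close> and \<open>M\<close>, hence the
    common letters.\<close>
  let ?\<Sigma> = "alphabet C \<inter> dfa_alphabet M"
  let ?f = "foldl (dfa_step M)" and ?q = "dfa_start M"
  define h where "h = (\<lambda>N v. concat (replicate N (some_loop M (suff K v))))"
  have start: "?q \<in> dfa_states M" using M(1) by (simp add: is_dfa_def)
  have w\<Sigma>: "w \<in> lists ?\<Sigma>" using w M(2) by (auto simp: aca_lang_def dfa_lang_def)
  have h\<Sigma>: "h N u \<in> lists ?\<Sigma>" if "u \<in> lists ?\<Sigma>" for N u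
  proof -
    have "set (h N u) \<subseteq> set (suff K u)" using set_mono_suffix[OF suffix_some_loop[of M "suff K u"]] by (auto simp: h_def)
    also have "\<dots> \<subseteq> set u" by (simp add: suff_def set_drop_subset)
    finally show ?thesis using that by auto
  qed
  have cong: "h N (c @ u) = h N (c' @ u)" if "length u \<ge> K" for N c c' u
    unfolding h_def suff_append_cong[OF that, of c c'] ..
  have long: "N \<le> length (expand (h N) c u)" if "u \<in> lists ?\<Sigma>" "length u = K" for N c u
    unfolding h_def using that by (intro length_expand_loops[OF M(1) K]) auto
  have loop: "?f ?q (u @ h N u) = ?f ?q u" if "u \<in> lists ?\<Sigma>" for N u
    unfolding h_def using that by (intro foldl_some_loop[OF M(1) start]) auto
  have state: "?f ?q (expand (h N) [] v) = ?f ?q v" if "v \<in> lists ?\<Sigma>" for N v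
    using foldl_expand[where h = "h N" and c = "[]", OF loop _ that] by simp
  have expand\<Sigma>: "expand (h N) [] v \<in> lists ?\<Sigma>" if "v \<in> lists ?\<Sigma>" for N v
    using that by (intro expand_in_lists h\<Sigma>) auto
  have expand_mem: "expand (h N) [] v \<in> dfa_lang M \<longleftrightarrow> v \<in> dfa_lang M" if "v \<in> lists ?\<Sigma>" for N v
    using state[OF that] that expand\<Sigma>[OF that] by (auto simp: dfa_lang_def)
  have lower: "N \<le> length (expand (h N) [] w)" for N
  proof -
    have "take K w \<in> lists ?\<Sigma>" using w\<Sigma> by (auto dest: in_set_takeD)
    then have "N \<le> length (expand (h N) [] (take K w))" using len by (intro long) auto
    also have "\<dots> \<le> length (expand (h N) [] (take K w @ drop K w))" by (simp only: expand_append) simp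
    finally show ?thesis by simp
  qed
  \<comment> \<open>The factor depends on the fixed word \<open>w\<close>, which is harmless: only
    linearity in \<open>N\<close> matters.\<close>
  have upper: "length (expand (h N) [] w) \<le> (length w * Suc K) * Suc N" for N
  proof -
    have "length (h N u) \<le> N * K" for u
      using suffix_length_le[OF suffix_some_loop[of M "suff K u"]]
      by (auto simp: h_def length_concat_replicate suff_def intro: mult_le_mono2)
    then have "length (expand (h N) [] w) \<le> length w * Suc (N * K)" by (rule length_expand_le)
    also have "\<dots> \<le> length w * (Suc K * Suc N)" by (intro mult_le_mono2) simp
    finally show ?thesis by (simp only: mult.assoc)
  qed
  obtain N where N: "t (length (expand (h N) [] w)) \<le> N"
    using sublinear_eventually_le[where f = "\<lambda>N. length (expand (h N) [] w)", OF assms(1) lower upper] by blast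
  have W: "expand (h N) [] w \<in> aca_lang C" using expand_mem[OF w\<Sigma>] w M(2) by simp
  define \<tau> where "\<tau> = acceptance_time C (expand (h N) [] w)"
  have \<tau>: "\<tau> \<le> N" using C(2) W N unfolding \<tau>_def by (meson le_trans)
  have "accepting_at C (expand (h N) [] w') \<tau>"
  proof (rule accepting_at_expand[where h = "h N" and K = K and w = w, OF C(1) h\<Sigma> _ cong _ w' eq len])
    show "\<tau> \<le> length (expand (h N) c u)" if "u \<in> lists ?\<Sigma>" "length u = K" for c u
      using \<tau> long[OF that, of N c] by linarith
    show "accepting_at C (expand (h N) [] w) \<tau>"
      unfolding \<tau>_def by (rule accepting_at_acceptance_time[OF W])
  qed simp_all
  moreover have "expand (h N) [] w' \<in> lists ?\<Sigma>" using w' by (rule expand\<Sigma>)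
  moreover have "expand (h N) [] w' \<noteq> []" using len by (cases w') auto
  ultimately have "expand (h N) [] w' \<in> aca_lang C" by (auto simp: aca_lang_def)
  then show ?thesis using expand_mem[OF w'] M(2) by simp
qed

lemma locally_testableI:
  assumes "L \<subseteq> lists \<Sigma>"
    and "\<And>w1 w2. w1 \<in> lists \<Sigma> \<Longrightarrow> w2 \<in> lists \<Sigma> \<Longrightarrow> pref k w1 = pref k w2 \<Longrightarrow>
      infixes k w1 = infixes k w2 \<Longrightarrow> suff k w1 = suff k w2 \<Longrightarrow> w1 \<in> L \<longleftrightarrow> w2 \<in> L"
    and "k > 0"
  shows "locally_testable \<Sigma> L"
proof -
  have "\<forall>w1\<in>lists \<Sigma>. \<forall>w2\<in>lists \<Sigma>.
      pref k w1 = pref k w2 \<and> infixes k w1 = infixes k w2 \<and> suff k w1 = suff k w2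
      \<longrightarrow> (w1 \<in> L \<longleftrightarrow> w2 \<in> L)"
    by (intro ballI impI, elim conjE) (rule assms(2))
  with assms(1,3) show ?thesis unfolding locally_testable_def by (intro conjI exI[of _ k])
qed

lemma ACA_REG_subset_LT:
  assumes "(\<lambda>n. real (t n)) \<in> o(\<lambda>n. real n)"
  shows "ACA t \<inter> REG \<subseteq> LT"
proof
  fix L :: "'a list set"
  assume "L \<in> ACA t \<inter> REG"
  then obtain C M where L: "L = aca_lang C" "[] \<notin> L"
    and C: "is_aca C" "\<forall>w\<in>aca_lang C. acceptance_time C w \<le> t (length w)"
    and M: "is_dfa M" "aca_lang C = dfa_lang M" unfolding ACA_def REG_def by blast
  let ?\<Sigma> = "alphabet C \<inter> dfa_alphabet M"
  define K where "K = card (dfa_states M \<rightarrow>\<^sub>E dfa_states M)"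
  have iff: "w1 \<in> L \<longleftrightarrow> w2 \<in> L"
    if "w1 \<in> lists ?\<Sigma>" "w2 \<in> lists ?\<Sigma>" "pref (3 * K + 1) w1 = pref (3 * K + 1) w2"
      "infixes (3 * K + 1) w1 = infixes (3 * K + 1) w2" "suff (3 * K + 1) w1 = suff (3 * K + 1) w2" for w1 w2
    using ACA_REG_closed[OF assms C M K_def that(2-5)]
      ACA_REG_closed[OF assms C M K_def that(1) that(3-5)[symmetric]] unfolding L(1) by (rule iffI)
  have "L \<subseteq> lists ?\<Sigma>"
  proof -
    have "aca_lang C \<subseteq> lists (alphabet C)" "dfa_lang M \<subseteq> lists (dfa_alphabet M)"
      by (auto simp: aca_lang_def dfa_lang_def)
    then show ?thesis unfolding L(1) lists_Int_eq using M(2) by blast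
  qed
  then have "locally_testable ?\<Sigma> L"
    by (rule locally_testableI[where k = "3 * K + 1"]) (rule iff, assumption+, simp)
  moreover have "finite ?\<Sigma>" using M(1) by (simp add: is_dfa_def)
  ultimately show "L \<in> LT" using L(2) unfolding LT_def by blast
qed

subsection \<open>Strictness\<close>

lemma mem_infixes_1: "[b] \<in> infixes 1 w \<longleftrightarrow> b \<in> set w"
proof (cases "length w \<le> 1")
  case True
  then show ?thesis by (cases w) (auto simp: infixes_def)
next
  case False
  then show ?thesis by (auto simp: infixes_def sublist_def in_set_conv_decomp)
qed

lemma words_containing_in_LT:
  assumes "finite \<Sigma>"
  shows "{w \<in> lists \<Sigma>. b \<in> set w} \<in> LT"
proof -
  have "locally_testable \<Sigma> {w \<in> lists \<Sigma>. b \<in> set w}"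
  proof (rule locally_testableI)
    fix w1 w2 :: "'a list"
    \<comment> \<open>This fixes the window length at 1, where the infixes record exactly the
      letters that occur.\<close>
    assume "infixes 1 w1 = infixes 1 w2"
    then have "b \<in> set w1 \<longleftrightarrow> b \<in> set w2" by (simp only: mem_infixes_1[symmetric])
    moreover assume "w1 \<in> lists \<Sigma>" "w2 \<in> lists \<Sigma>"
    ultimately show "w1 \<in> {w \<in> lists \<Sigma>. b \<in> set w} \<longleftrightarrow> w2 \<in> {w \<in> lists \<Sigma>. b \<in> set w}"
      by simp
  qed auto
  with assms show ?thesis by (auto simp: LT_def)
qed

lemma words_containing_not_in_ACA:
  assumes "(\<lambda>n. real (t n)) \<in> o(\<lambda>n. real n)" and "a \<noteq> b"
  shows "{w \<in> lists {a, b}. b \<in> set w} \<notin> ACA t"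
proof
  assume "{w \<in> lists {a, b}. b \<in> set w} \<in> ACA t"
  then obtain C where L: "{w \<in> lists {a, b}. b \<in> set w} = aca_lang C"
    and C: "is_aca C" "\<forall>w\<in>aca_lang C. acceptance_time C w \<le> t (length w)" by (auto simp: ACA_def)
  have "4 * N + 1 \<le> 4 * Suc N" for N :: nat by simp
  then obtain N where N: "N > 0" "t (4 * N + 1) \<le> N"
    using sublinear_eventually_le[OF assms(1), of "\<lambda>N. 4 * N + 1" 4] by auto
  \<comment> \<open>With \<open>2 * N\<close> letters in \<open>u\<close> and acceptance by time
    \<open>N\<close>, no ball of radius \<tau> around a position of \<open>u\<close> crosses both of
    its ends.\<close>
  define u where "u = replicate (2 * N) a"
  have w: "u @ b # u \<in> aca_lang C" unfolding L[symmetric] by (auto simp: u_def)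
  define \<tau> where "\<tau> = acceptance_time C (u @ b # u)"
  have "length (u @ b # u) = 4 * N + 1" by (simp add: u_def)
  then have \<tau>: "\<tau> \<le> N" using bspec[OF C(2) w] N(2) by (simp only: \<tau>_def)
  have u: "u \<in> lists (alphabet C)" using w by (auto simp: aca_lang_def)
  have "accepting_at C u \<tau>"
  proof (rule accepting_at_local[OF C(1) u])
    show "accepting_at C (u @ b # u) \<tau>" unfolding \<tau>_def by (rule accepting_at_acceptance_time[OF w])
    fix i
    assume i: "i < length u"
    show "\<exists>A A' X B B' r. u @ b # u = A @ X @ B \<and> u = A' @ X @ B' \<and>
           i = length A' + r \<and> r < length X \<and> (\<tau> \<le> r \<or> A = [] \<and> A' = []) \<and>
           (r + \<tau> < length X \<or> B = [] \<and> B' = [])"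
    proof (cases "\<tau> \<le> i")
      \<comment> \<open>The ball does not cross the left end, so it is matched in the copy of
        \<open>u\<close> after \<open>b\<close>, where the right end agrees.\<close>
      case True
      with i show ?thesis
        by (intro exI[of _ "u @ [b]"] exI[of _ "[]"] exI[of _ u] exI[of _ i]) simp
    next
      \<comment> \<open>The ball does not cross the right end, so it is matched in the copy of
        \<open>u\<close> before \<open>b\<close>, where the left end agrees.\<close>
      case False
      with i \<tau> have "i + \<tau> < length u" by (simp add: u_def)
      with i show ?thesis
        by (intro exI[of _ "[]"] exI[of _ u] exI[of _ "b # u"] exI[of _ i]) simp
    qed
  qed
  moreover have "u \<noteq> []" using N(1) by (simp add: u_def)
  ultimately have "u \<in> aca_lang C" using u by (auto simp: aca_lang_def)
  then have "b \<in> set u" unfolding L[symmetric] by simp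
  then show False using assms(2) by (simp add: u_def)
qed

theorem theorem5:
  fixes t :: "nat \<Rightarrow> nat"
  assumes "(\<lambda>n. real (t n)) \<in> o(\<lambda>n. real n)"
  shows "(ACA t :: 'a::infinite list set set) \<inter> REG \<subset> LT"
proof -
  obtain a b :: 'a where "a \<noteq> b"
    using ex_new_if_finite[OF infinite_UNIV, of "{undefined :: 'a}"] by auto
  then have "{w \<in> lists {a, b}. b \<in> set w} \<in> LT - ACA t"
    using words_containing_in_LT[of "{a, b}"] words_containing_not_in_ACA[OF assms] by simp
  then show ?thesis using ACA_REG_subset_LT[OF assms] by blast
qed

end
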